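(* Let $R$ be a Krull domain. Let $f$ be an irreducible power series in $R[[t]]$. Then there exists an integer $n\geq 1$ such that $f$ is irreducible modulo $t^n$.
   Context: A domain is a commutative integral domain. A non-zero non-unit of a domain is irreducible if it is not a product of two non-units. For a domain $R$, a non-unit $f\in R[[t]]$ and an integer $n\geq 1$, $f$ is irreducible modulo $t^n$ if there do not exist non-units $g,h\in R[[t]]$ such that $f\equiv gh \pmod{t^n}$. A domain $R$ is a Krull domain if: (1) $\bigcap_{\mathfrak p} R_{\mathfrak p}=R$, the intersection being over all height-1 prime ideals $\mathfrak p$ of $R$; (2) each such $R_{\mathfrak p}$ is a (rank-1) discrete valuation ring; (3) each $0\neq a\in R$ is contained in only finitely many height-1 prime ideals. *)

theory Defs
  imports
    "HOL-Algebra.Algebraic_Closure_Type"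
    "HOL-Library.Extended_Nat"
begin

abbreviation prime_ideal :: "'a::comm_ring_1 set \<Rightarrow> bool" where
  "prime_ideal P \<equiv> primeideal P ring_of_type_algebra"

definition ideal_height :: "'a::comm_ring_1 set \<Rightarrow> enat" where
  "ideal_height P = Sup {enat n | n.
     \<exists>Q :: nat \<Rightarrow> 'a set. (\<forall>i\<le>n. prime_ideal (Q i)) \<and> (\<forall>i<n. Q i \<subset> Q (Suc i)) \<and> Q n = P}"

definition height_one_primes :: "'a::comm_ring_1 set set" where
  "height_one_primes = {P. prime_ideal P \<and> ideal_height P = 1}"

definition localization_at :: "'a::idom set \<Rightarrow> 'a fract set" where
  "localization_at P = {to_fract a / to_fract s | a s. s \<notin> P}"

text \<open>
  A discrete valuation is normalised, that is, surjective onto the integers. Its value at \<open>0\<close>,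
  conventionally infinite, is not used.
\<close>

definition discrete_valuation :: "('k::field \<Rightarrow> int) \<Rightarrow> bool" where
  "discrete_valuation v \<longleftrightarrow>
     (\<forall>x y. x \<noteq> 0 \<longrightarrow> y \<noteq> 0 \<longrightarrow> v (x * y) = v x + v y) \<and>
     (\<forall>x y. x \<noteq> 0 \<longrightarrow> y \<noteq> 0 \<longrightarrow> x + y \<noteq> 0 \<longrightarrow> min (v x) (v y) \<le> v (x + y)) \<and>
     v ` (- {0}) = UNIV"

text \<open>
  The field of fractions of the valuation ring of a valuation on a field is that whole field.
  Hence the next definition singles out the subrings of the ambient field that are discrete
  valuation rings and have the ambient field as their field of fractions. For localizations of a
  domain at its primes, inside its fraction field, the second condition is automatic.
\<close>

definition is_DVR :: "'k::field set \<Rightarrow> bool" where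
  "is_DVR A \<longleftrightarrow> (\<exists>v. discrete_valuation v \<and> A = {x. x = 0 \<or> v x \<ge> 0})"

text \<open>
  An empty intersection is the whole fraction field, so fields are Krull domains.
\<close>

definition krull_domain :: "'a::idom itself \<Rightarrow> bool" where
  "krull_domain _ \<longleftrightarrow>
     (\<Inter>P \<in> (height_one_primes :: 'a set set). localization_at P) = range to_fract \<and>
     (\<forall>P \<in> (height_one_primes :: 'a set set). is_DVR (localization_at P)) \<and>
     (\<forall>a :: 'a. a \<noteq> 0 \<longrightarrow> finite {P \<in> height_one_primes. a \<in> P})"

text \<open>Here \<open>fps_X\<close> is the variable \<open>t\<close>.\<close>

definition irreducible_mod_X_power :: "nat \<Rightarrow> 'a::idom fps \<Rightarrow> bool" where
  "irreducible_mod_X_power n f \<longleftrightarrow>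
     \<not> f dvd 1 \<and> \<not> (\<exists>g h. \<not> g dvd 1 \<and> \<not> h dvd 1 \<and> fps_X ^ n dvd f - g * h)"

end

theory Submission
  imports Defs "HOL-Library.Diagonal_Subsequence"
begin

text \<open>
  Suppose that \<open>f\<close> is congruent to a product of two non-units modulo every power of \<open>t\<close>. If the
  constant term of \<open>f\<close> vanishes, then \<open>f\<close> is \<open>t\<close> times a unit, and already modulo \<open>t\<^sup>2\<close> this is
  impossible. Otherwise let \<open>f \<equiv> g\<^sub>n h\<^sub>n\<close> modulo \<open>t\<^sup>n\<close>, with constant terms that are all non-zero. The
  factors \<open>g\<^sub>n\<close> are to be shown to converge, after passing to a subsequence and multiplying them by
  units; the limit then divides \<open>f\<close>, and \<open>f\<close> is reducible.
  
  Convergence up to units follows from a finiteness property: for each \<open>M\<close>, the factors of \<open>f\<close>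
  modulo \<open>t\<^sup>N\<close> with \<open>N\<close> large fall into finitely many classes when they are read modulo \<open>t\<^sup>M\<close> and
  up to units. Two series with non-zero constant terms are in the same class exactly when their two
  quotients, formed over the field of fractions, have their first \<open>M\<close> coefficients in the ring. In
  a Krull domain this can be tested in the discrete valuation rings \<open>R\<^sub>P\<close> for the height-one primes
  \<open>P\<close>. When \<open>P\<close> does not contain the constant term of \<open>f\<close>, every factor of \<open>f\<close> is a unit over
  \<open>R\<^sub>P\<close>, so only finitely many \<open>P\<close> matter (\<open>krull_approximate_factors_subsequence\<close>). This reduces
  the finiteness property to a discrete valuation ring \<open>V\<close> with valuation \<open>v\<close>.
  
  Over \<open>V\<close>, inverting \<open>t\<close> makes the power series ring Euclidean, the size of a series being the
  valuation of its lowest non-zero coefficient. The Euclidean algorithm, truncated at \<open>t\<^sup>T\<close>, either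
  writes a power of \<open>t\<close> with controlled exponent as a combination of two given series, or it finds a
  common non-unit factor modulo \<open>t\<^sup>T\<close> (\<open>bezout_or_common_factor\<close>). Hence a series that is
  irreducible modulo \<open>t\<^sup>T\<close> is approximately prime, with a loss of precision that depends only on
  \<open>T\<close> and on the valuation of its constant term (\<open>irreducible_upto_imp_prime\<close>).
  
  Let \<open>r\<close> be the largest number of non-units into which \<open>f\<close> factors modulo every power of \<open>t\<close>. It
  exists because valuations of constant terms add up. For a suitable \<open>T\<close> there is no factorization
  into \<open>r + 1\<close> non-units modulo \<open>t\<^sup>T\<close>, so the \<open>r\<close> factors modulo a higher power \<open>t\<^sup>N\<close> are all
  irreducible modulo the fixed power \<open>t\<^sup>T\<close>, hence approximately prime with a loss independent of
  \<open>N\<close>. Therefore factorization is approximately unique, and the factors of \<open>f\<close> modulo \<open>t\<^sup>N\<close> are,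
  modulo \<open>t\<^sup>M\<close> and up to units, the at most \<open>2\<^sup>r\<close> subproducts of one fixed factorization
  (\<open>finite_factor_classes\<close>).
\<close>

section \<open>Power series agreeing up to a given order\<close>

definition agree :: "nat \<Rightarrow> 'a::zero fps \<Rightarrow> 'a fps \<Rightarrow> bool" where
  "agree n x y \<longleftrightarrow> (\<forall>i<n. x $ i = y $ i)"

lemma agree_refl [simp]: "agree n x x"
  by (simp add: agree_def)

lemma agree_sym: "agree n x y \<Longrightarrow> agree n y x"
  by (simp add: agree_def)

lemma agree_trans [trans]: "agree n x y \<Longrightarrow> agree n y z \<Longrightarrow> agree n x z"
  by (simp add: agree_def)

lemma agree_mono: "agree n x y \<Longrightarrow> m \<le> n \<Longrightarrow> agree m x y"
  by (simp add: agree_def)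

lemma agree_nth_0: "agree n x y \<Longrightarrow> 0 < n \<Longrightarrow> x $ 0 = y $ 0"
  by (simp add: agree_def)

lemma agree_mult:
  fixes x y :: "'a::comm_ring_1 fps"
  assumes "agree n x x'" "agree n y y'"
  shows "agree n (x * y) (x' * y')"
  using assms by (auto simp: agree_def fps_mult_nth intro!: sum.cong)

lemma agree_mult_left: "agree n y y' \<Longrightarrow> agree n (x * y) (x * y')"
  for x y :: "'a::comm_ring_1 fps"
  by (rule agree_mult) simp_all

lemma agree_imp_eq_add_X_power:
  fixes x y :: "'a::comm_ring_1 fps"
  assumes "agree n x y"
  shows "x = y + fps_X ^ n * fps_shift n (x - y)"
  using assms by (auto simp: fps_eq_iff agree_def fps_X_power_mult_nth)

lemma X_power_dvd_diff_iff_agree: "fps_X ^ n dvd x - y \<longleftrightarrow> agree n x y"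
  for x y :: "'a::comm_ring_1 fps"
proof
  assume "fps_X ^ n dvd x - y"
  then obtain z where "x - y = fps_X ^ n * z" by (elim dvdE)
  then have "(x - y) $ i = 0" if "i < n" for i
    using that by (simp add: fps_X_power_mult_nth)
  then show "agree n x y" by (simp add: agree_def)
next
  assume "agree n x y"
  then have "x - y = fps_X ^ n * fps_shift n (x - y)"
    using agree_imp_eq_add_X_power[of n x y] by (simp add: algebra_simps)
  then show "fps_X ^ n dvd x - y" by (metis dvd_triv_left)
qed

text \<open>
  Cancelling a series with non-zero constant term costs no precision, unlike cancelling a power of
  \<open>t\<close>. The argument below keeps constant terms non-zero for this reason.
\<close>

lemma agree_mult_cancel_left:
  fixes g x y :: "'a::idom fps"
  assumes "agree n (g * x) (g * y)" "g $ 0 \<noteq> 0"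
  shows "agree n x y"
  unfolding agree_def
proof (intro allI impI)
  fix i assume "i < n"
  then show "x $ i = y $ i"
  proof (induction i rule: less_induct)
    case (less i)
    have *: "(g * z) $ i = g $ 0 * z $ i + (\<Sum>j\<in>{1..i}. g $ j * z $ (i - j))" for z :: "'a fps"
      by (simp add: fps_mult_nth sum.atLeast_Suc_atMost)
    have "(\<Sum>j\<in>{1..i}. g $ j * x $ (i - j)) = (\<Sum>j\<in>{1..i}. g $ j * y $ (i - j))"
      using less by (intro sum.cong) auto
    moreover have "(g * x) $ i = (g * y) $ i"
      using assms(1) less.prems by (simp add: agree_def)
    ultimately have "g $ 0 * x $ i = g $ 0 * y $ i"
      by (simp add: *)
    then show ?case using assms(2) by simp
  qed
qed

lemma fps_dvd_1_iff: "x dvd 1 \<longleftrightarrow> x $ 0 dvd 1"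
  for x :: "'a::comm_ring_1 fps"
proof
  assume "x dvd 1"
  then obtain y where "1 = x * y" by (elim dvdE)
  then have "1 = x $ 0 * y $ 0" by (metis fps_mult_nth_0 fps_one_nth)
  then show "x $ 0 dvd 1" by (metis dvd_triv_left)
next
  assume "x $ 0 dvd 1"
  then obtain c where "x $ 0 * c = 1" by (metis dvdE)
  then have "x * fps_right_inverse x c = 1" by (rule fps_right_inverse)
  then show "x dvd 1" by (metis dvd_triv_left)
qed


section \<open>Power series over a discrete valuation ring\<close>

text \<open>
  For a subring \<open>A\<close> and series with non-zero constant terms, this says that \<open>x\<close> and \<open>y\<close> differ
  modulo \<open>t\<^sup>n\<close> by a unit of \<open>A[[t]]\<close>. Stated through quotients, it is a condition on single
  coefficients and so passes to intersections of rings.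
\<close>

definition assoc_upto :: "'k::field set \<Rightarrow> nat \<Rightarrow> 'k fps \<Rightarrow> 'k fps \<Rightarrow> bool" where
  "assoc_upto A n x y \<longleftrightarrow> (\<forall>i<n. (x * inverse y) $ i \<in> A \<and> (y * inverse x) $ i \<in> A)"

lemma assoc_upto_sym: "assoc_upto A n x y \<Longrightarrow> assoc_upto A n y x"
  by (simp add: assoc_upto_def)

locale discretely_valued_field =
  fixes v :: "'k::field \<Rightarrow> int"
  assumes discrete_valuation: "discrete_valuation v"
begin

lemma v_mult: "x \<noteq> 0 \<Longrightarrow> y \<noteq> 0 \<Longrightarrow> v (x * y) = v x + v y"
  using discrete_valuation by (simp add: discrete_valuation_def)

lemma v_add: "x \<noteq> 0 \<Longrightarrow> y \<noteq> 0 \<Longrightarrow> x + y \<noteq> 0 \<Longrightarrow> min (v x) (v y) \<le> v (x + y)"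
  using discrete_valuation by (simp add: discrete_valuation_def)

lemma v_1: "v 1 = 0"
  using v_mult[of 1 1] by simp

lemma v_inverse: "x \<noteq> 0 \<Longrightarrow> v (inverse x) = - v x"
  using v_mult[of x "inverse x"] v_1 by simp

lemma v_minus: "v (- x) = v x"
proof (cases "x = 0")
  case False
  have "v (-1) + v (-1) = 0" using v_mult[of "-1" "-1"] v_1 by simp
  then show ?thesis using v_mult[of "-1" x] False by simp
qed simp

definition valuation_ring :: "'k set" where
  "valuation_ring = {x. x = 0 \<or> v x \<ge> 0}"

lemma valuation_ring_0: "0 \<in> valuation_ring"
  and valuation_ring_1: "1 \<in> valuation_ring"
  by (simp_all add: valuation_ring_def v_1)

lemma valuation_ring_add: "x \<in> valuation_ring \<Longrightarrow> y \<in> valuation_ring \<Longrightarrow> x + y \<in> valuation_ring"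
  using v_add[of x y] by (cases "x = 0 \<or> y = 0 \<or> x + y = 0") (auto simp: valuation_ring_def)

lemma valuation_ring_mult: "x \<in> valuation_ring \<Longrightarrow> y \<in> valuation_ring \<Longrightarrow> x * y \<in> valuation_ring"
  using v_mult[of x y] by (cases "x = 0 \<or> y = 0") (auto simp: valuation_ring_def)

lemma valuation_ring_minus: "x \<in> valuation_ring \<Longrightarrow> - x \<in> valuation_ring"
  by (auto simp: valuation_ring_def v_minus)

lemma valuation_ring_sum: "(\<And>i. i \<in> I \<Longrightarrow> h i \<in> valuation_ring) \<Longrightarrow> sum h I \<in> valuation_ring"
  by (induction I rule: infinite_finite_induct) (auto intro: valuation_ring_0 valuation_ring_add)

definition integral_series :: "'k fps set" where
  "integral_series = {x. \<forall>i. x $ i \<in> valuation_ring}"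

lemma integral_series_0: "0 \<in> integral_series"
  and integral_series_1: "1 \<in> integral_series"
  by (simp_all add: integral_series_def valuation_ring_0 valuation_ring_1)

lemma integral_series_const: "c \<in> valuation_ring \<Longrightarrow> fps_const c \<in> integral_series"
  by (simp add: integral_series_def valuation_ring_0)

lemma integral_series_X_power: "fps_X ^ n \<in> integral_series"
  by (simp add: integral_series_def valuation_ring_0 valuation_ring_1)

lemma integral_series_add: "x \<in> integral_series \<Longrightarrow> y \<in> integral_series \<Longrightarrow> x + y \<in> integral_series"
  by (simp add: integral_series_def valuation_ring_add)

lemma integral_series_mult: "x \<in> integral_series \<Longrightarrow> y \<in> integral_series \<Longrightarrow> x * y \<in> integral_series"
  by (simp add: integral_series_def fps_mult_nth valuation_ring_sum valuation_ring_mult)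

lemma integral_series_minus: "x \<in> integral_series \<Longrightarrow> - x \<in> integral_series"
  by (simp add: integral_series_def valuation_ring_minus)

lemma integral_series_diff: "x \<in> integral_series \<Longrightarrow> y \<in> integral_series \<Longrightarrow> x - y \<in> integral_series"
  using integral_series_add[of x "- y"] integral_series_minus[of y] by simp

lemma integral_series_shift: "x \<in> integral_series \<Longrightarrow> fps_shift n x \<in> integral_series"
  by (simp add: integral_series_def)

lemmas integral_series_intros =
  integral_series_0 integral_series_1 integral_series_const integral_series_X_power
  integral_series_add integral_series_mult integral_series_minus integral_series_diff
  integral_series_shift

lemma integral_series_nth_0: "x \<in> integral_series \<Longrightarrow> x $ 0 \<noteq> 0 \<Longrightarrow> 0 \<le> v (x $ 0)"
  by (auto simp: integral_series_def valuation_ring_def)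

definition unit_series :: "'k fps \<Rightarrow> bool" where
  "unit_series u \<longleftrightarrow> u \<in> integral_series \<and> u $ 0 \<noteq> 0 \<and> v (u $ 0) = 0"

definition nonunit_series :: "'k fps \<Rightarrow> bool" where
  "nonunit_series x \<longleftrightarrow> x \<in> integral_series \<and> x $ 0 \<noteq> 0 \<and> 0 < v (x $ 0)"

lemma unit_series_inverse:
  assumes "unit_series u"
  shows "unit_series (inverse u)"
proof -
  have u: "u \<in> integral_series" "u $ 0 \<noteq> 0" "v (u $ 0) = 0"
    using assms by (auto simp: unit_series_def)
  have "inverse u $ n \<in> valuation_ring" for n
  proof (induction n rule: less_induct)
    case (less n)
    have c: "inverse (u $ 0) \<in> valuation_ring"
      using u v_inverse by (simp add: valuation_ring_def)
    show ?case
    proof (cases "n = 0")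
      case True
      then show ?thesis using c by simp
    next
      case False
      have "(u * inverse u) $ n = 0"
        using u(2) False by (simp add: inverse_mult_eq_1')
      then have "u $ 0 * inverse u $ n = - (\<Sum>j\<in>{1..n}. u $ j * inverse u $ (n - j))"
        by (simp add: fps_mult_nth sum.atLeast_Suc_atMost eq_neg_iff_add_eq_0)
      then have "inverse u $ n
          = inverse (u $ 0) * (- (\<Sum>j\<in>{1..n}. u $ j * inverse u $ (n - j)))"
        using u(2) by (simp add: field_simps)
      also have "\<dots> \<in> valuation_ring"
        using u(1) less c
        by (intro valuation_ring_mult valuation_ring_minus valuation_ring_sum)
          (auto simp: integral_series_def)
      finally show ?thesis .
    qed
  qed
  then show ?thesis
    using u v_inverse by (simp add: unit_series_def integral_series_def)
qed

text \<open>
  The quotient is built one coefficient at a time. The first coefficient of \<open>a\<close> that cannot be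
  cleared by \<open>b\<close> is one that \<open>b $ 0\<close> does not divide, hence has smaller valuation than \<open>b $ 0\<close>. So
  \<open>r\<close>, freed from its power of \<open>t\<close>, is a smaller remainder in the Euclidean sense.
\<close>

lemma division_step:
  assumes a: "a \<in> integral_series" and b: "b \<in> integral_series" "b $ 0 \<noteq> 0"
  shows "(\<exists>q\<in>integral_series. agree T a (q * b)) \<or>
    (\<exists>q\<in>integral_series. \<exists>r\<in>integral_series. \<exists>j<T.
       a = q * b + fps_X ^ j * r \<and> r $ 0 \<noteq> 0 \<and> v (r $ 0) < v (b $ 0))"
proof (induction T)
  case 0
  show ?case using integral_series_0 by (auto simp: agree_def)
next
  case (Suc T)
  then show ?case
  proof
    assume "\<exists>q\<in>integral_series. agree T a (q * b)"
    then obtain q where q: "q \<in> integral_series" "agree T a (q * b)" by blast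
    define r where "r = fps_shift T (a - q * b)"
    have r: "r \<in> integral_series"
      unfolding r_def using a b q by (intro integral_series_intros)
    have eq: "a = q * b + fps_X ^ T * r"
      unfolding r_def by (rule agree_imp_eq_add_X_power[OF q(2)])
    show ?thesis
    proof (cases "r $ 0 \<noteq> 0 \<and> v (r $ 0) < v (b $ 0)")
      case True
      then show ?thesis using q r eq by blast
    next
      case False
      \<comment> \<open>Coefficient \<open>T\<close> of the difference is divisible by \<open>b $ 0\<close>; \<open>c\<close> clears it.\<close>
      define c where "c = r $ 0 / b $ 0"
      have "c \<in> valuation_ring"
        using False b v_mult[of "r $ 0" "inverse (b $ 0)"] v_inverse[of "b $ 0"]
        by (cases "r $ 0 = 0") (auto simp: c_def valuation_ring_def divide_inverse)
      then have q': "q + fps_X ^ T * fps_const c \<in> integral_series"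
        using q by (intro integral_series_intros)
      have "a - (q + fps_X ^ T * fps_const c) * b = fps_X ^ T * (r - fps_const c * b)"
        by (subst eq) (simp add: algebra_simps)
      moreover have "(fps_X ^ T * (r - fps_const c * b)) $ i = 0" if "i < Suc T" for i
        using that b by (auto simp: fps_X_power_mult_nth c_def less_Suc_eq)
      ultimately have "agree (Suc T) a ((q + fps_X ^ T * fps_const c) * b)"
        unfolding agree_def by (metis fps_sub_nth right_minus_eq)
      then show ?thesis using q' by blast
    qed
  next
    assume "\<exists>q\<in>integral_series. \<exists>r\<in>integral_series. \<exists>j<T.
       a = q * b + fps_X ^ j * r \<and> r $ 0 \<noteq> 0 \<and> v (r $ 0) < v (b $ 0)"
    then show ?thesis by (meson less_SucI)
  qed
qed

text \<open>
  The Euclidean algorithm for \<open>a\<close> and \<open>b\<close>. Each division step strips less than \<open>T\<close> powers of \<open>t\<close>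
  from the remainder and lowers the valuation of its constant term, which bounds the exponent \<open>E\<close>. If
  a division leaves no remainder below \<open>t\<^sup>T\<close>, then the divisor at that stage is the common factor;
  tracing it back to \<open>a\<close> and \<open>b\<close> only multiplies, so no precision is lost on the way.
\<close>

lemma bezout_or_common_factor:
  assumes "a \<in> integral_series" "b \<in> integral_series" "b $ 0 \<noteq> 0"
  shows "(\<exists>E\<le>T * nat (v (b $ 0)). \<exists>\<alpha>\<in>integral_series. \<exists>\<beta>\<in>integral_series.
            fps_X ^ E = \<alpha> * a + \<beta> * b) \<or>
    (\<exists>d e e'. nonunit_series d \<and> e \<in> integral_series \<and> e' \<in> integral_series \<and>
       v (d $ 0) \<le> v (b $ 0) \<and> agree T a (d * e) \<and> agree T b (d * e'))"
  using assms
proof (induction "nat (v (b $ 0))" arbitrary: a b rule: less_induct)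
  case less
  note a = less.prems(1) and b = less.prems(2,3)
  have vb: "0 \<le> v (b $ 0)" using integral_series_nth_0 b by blast
  show ?case
  proof (cases "v (b $ 0) = 0")
    case True
    then have "unit_series b" using b by (simp add: unit_series_def)
    then have "inverse b \<in> integral_series"
      using unit_series_inverse by (simp add: unit_series_def)
    moreover have "fps_X ^ 0 = 0 * a + inverse b * b"
      using b(2) by (simp add: inverse_mult_eq_1)
    ultimately show ?thesis using integral_series_0 by blast
  next
    case False
    then have nb: "nonunit_series b" using b vb by (simp add: nonunit_series_def)
    consider (div) q where "q \<in> integral_series" "agree T a (q * b)"
      | (rem) q r j where "q \<in> integral_series" "r \<in> integral_series" "j < T"
         "a = q * b + fps_X ^ j * r" "r $ 0 \<noteq> 0" "v (r $ 0) < v (b $ 0)"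
      using division_step[OF a b, of T] by blast
    then show ?thesis
    proof cases
      case div
      then have "agree T a (b * q)" "agree T b (b * 1)" by (simp_all add: mult.commute)
      then show ?thesis using nb div(1) integral_series_1 by blast
    next
      case rem
      have vr: "0 \<le> v (r $ 0)" using integral_series_nth_0 rem by blast
      then have "nat (v (r $ 0)) < nat (v (b $ 0))" using rem by simp
      from less.hyps[OF this b(1) rem(2,5)] show ?thesis
      proof (elim disjE)
        assume "\<exists>E\<le>T * nat (v (r $ 0)). \<exists>\<alpha>\<in>integral_series. \<exists>\<beta>\<in>integral_series.
            fps_X ^ E = \<alpha> * b + \<beta> * r"
        then obtain E \<alpha> \<beta> where E: "E \<le> T * nat (v (r $ 0))"
          and \<alpha>\<beta>: "\<alpha> \<in> integral_series" "\<beta> \<in> integral_series"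
          and eq: "fps_X ^ E = \<alpha> * b + \<beta> * r" by blast
        have "E + j \<le> T * nat (v (r $ 0)) + T" using E rem(3) by simp
        also have "\<dots> = T * Suc (nat (v (r $ 0)))" by simp
        also have "\<dots> \<le> T * nat (v (b $ 0))"
          using rem(6) vr by (intro mult_le_mono2) simp
        finally have "E + j \<le> T * nat (v (b $ 0))" .
        moreover have "fps_X ^ (E + j) = \<beta> * a + (fps_X ^ j * \<alpha> - \<beta> * q) * b"
          by (simp add: power_add eq rem(4) algebra_simps)
        moreover have "fps_X ^ j * \<alpha> - \<beta> * q \<in> integral_series"
          using \<alpha>\<beta> rem by (intro integral_series_intros)
        ultimately show ?thesis using \<alpha>\<beta> by blast
      next
        assume "\<exists>d e e'. nonunit_series d \<and> e \<in> integral_series \<and> e' \<in> integral_series \<and>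
          v (d $ 0) \<le> v (r $ 0) \<and> agree T b (d * e) \<and> agree T r (d * e')"
        then obtain d e e' where d: "nonunit_series d" "v (d $ 0) \<le> v (r $ 0)"
          and e: "e \<in> integral_series" "e' \<in> integral_series"
          and ag: "agree T b (d * e)" "agree T r (d * e')" by blast
        have "agree T (q * b + fps_X ^ j * r) (q * (d * e) + fps_X ^ j * (d * e'))"
          using agree_mult_left[OF ag(1), of q] agree_mult_left[OF ag(2), of "fps_X ^ j"]
          by (simp add: agree_def)
        then have "agree T a (d * (q * e + fps_X ^ j * e'))"
          by (simp add: rem(4) algebra_simps)
        moreover have "q * e + fps_X ^ j * e' \<in> integral_series"
          using e rem by (intro integral_series_intros)
        ultimately show ?thesis using d e ag rem(6) by (meson less_imp_le order_trans)
      qed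
    qed
  qed
qed

definition irreducible_upto :: "nat \<Rightarrow> 'k fps \<Rightarrow> bool" where
  "irreducible_upto T g \<longleftrightarrow> nonunit_series g \<and>
     \<not> (\<exists>d e. nonunit_series d \<and> nonunit_series e \<and> agree T g (d * e))"

text \<open>
  If \<open>g\<close> does not divide \<open>x\<close> modulo \<open>t\<^sup>M\<close>, a remainder \<open>r\<close> survives that is smaller than \<open>g\<close>. A
  common factor of \<open>g\<close> and \<open>r\<close> would be a proper factor of \<open>g\<close>, so a power of \<open>t\<close> is a combination of
  \<open>g\<close> and \<open>x\<close>. Multiplying by \<open>y\<close>, this power of \<open>t\<close> times \<open>y\<close> is approximately a multiple of \<open>g\<close>,
  and the power of \<open>t\<close> can be cancelled because \<open>g $ 0 \<noteq> 0\<close>. The required precision \<open>N\<close> depends on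
  \<open>g\<close> through the valuation of \<open>g $ 0\<close> alone.
\<close>

lemma irreducible_upto_imp_prime:
  assumes g: "irreducible_upto T g" and T: "0 < T"
    and x: "x \<in> integral_series" and y: "y \<in> integral_series" and q: "q \<in> integral_series"
    and N: "T * nat (v (g $ 0)) + 2 * M \<le> N" and eq: "agree N (x * y) (g * q)"
  shows "(\<exists>z\<in>integral_series. agree M x (g * z)) \<or> (\<exists>z\<in>integral_series. agree M y (g * z))"
proof -
  have g': "g \<in> integral_series" "g $ 0 \<noteq> 0" "0 < v (g $ 0)"
    using g by (auto simp: irreducible_upto_def nonunit_series_def)
  consider (div) z where "z \<in> integral_series" "agree M x (z * g)"
    | (rem) z r j where "z \<in> integral_series" "r \<in> integral_series" "j < M"
       "x = z * g + fps_X ^ j * r" "r $ 0 \<noteq> 0" "v (r $ 0) < v (g $ 0)"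
    using division_step[OF x g'(1,2), of M] by blast
  then show ?thesis
  proof cases
    case div
    then show ?thesis by (auto simp: mult.commute)
  next
    case rem
    from bezout_or_common_factor[OF g'(1) rem(2,5), of T] show ?thesis
    proof (elim disjE)
      assume "\<exists>d e e'. nonunit_series d \<and> e \<in> integral_series \<and> e' \<in> integral_series \<and>
          v (d $ 0) \<le> v (r $ 0) \<and> agree T g (d * e) \<and> agree T r (d * e')"
      then obtain d e where d: "nonunit_series d" "v (d $ 0) \<le> v (r $ 0)"
        and e: "e \<in> integral_series" and ag: "agree T g (d * e)" by blast
      have g0: "g $ 0 = d $ 0 * e $ 0" using agree_nth_0[OF ag T] by simp
      then have "e $ 0 \<noteq> 0" using g' by auto
      moreover have "v (g $ 0) = v (d $ 0) + v (e $ 0)"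
        unfolding g0 using d \<open>e $ 0 \<noteq> 0\<close> by (intro v_mult) (auto simp: nonunit_series_def)
      ultimately have "nonunit_series e"
        using e d rem(6) by (simp add: nonunit_series_def)
      then show ?thesis using g d ag by (auto simp: irreducible_upto_def)
    next
      assume "\<exists>E\<le>T * nat (v (r $ 0)). \<exists>\<alpha>\<in>integral_series. \<exists>\<beta>\<in>integral_series.
            fps_X ^ E = \<alpha> * g + \<beta> * r"
      then obtain E \<alpha> \<beta> where E: "E \<le> T * nat (v (r $ 0))"
        and \<alpha>\<beta>: "\<alpha> \<in> integral_series" "\<beta> \<in> integral_series"
        and eqE: "fps_X ^ E = \<alpha> * g + \<beta> * r" by blast
      define E' where "E' = E + j"
      define s where "s = fps_shift N (x * y - g * q)"
      have s: "s \<in> integral_series"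
        unfolding s_def using x y q g' by (intro integral_series_intros)
      have xy: "x * y = g * q + fps_X ^ N * s"
        unfolding s_def by (rule agree_imp_eq_add_X_power[OF eq])
      have "T * nat (v (r $ 0)) \<le> T * nat (v (g $ 0))"
        using rem(6) by (intro mult_le_mono2) simp
      then have E'M: "E' + M \<le> N"
        using E rem(3) N unfolding E'_def by linarith
      then have XN: "fps_X ^ N = fps_X ^ E' * (fps_X ^ (N - E') :: 'k fps)"
        by (simp flip: power_add)
      \<comment> \<open>\<open>w\<close> collects the multiples of \<open>g\<close> in \<open>fps_X ^ E' * y\<close>, after \<open>fps_X ^ E * fps_X ^ j\<close>
        has been expressed by \<open>g\<close> and \<open>x\<close>, and \<open>x * y\<close> by \<open>g * q\<close>.\<close>
      define w where "w = fps_X ^ j * \<alpha> * y - \<beta> * z * y + \<beta> * q"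
      have w: "w \<in> integral_series"
        unfolding w_def using \<alpha>\<beta> x y q rem by (intro integral_series_intros)
      have "fps_X ^ E' * y = (fps_X ^ j * \<alpha> - \<beta> * z) * g * y + \<beta> * (x * y)"
        by (simp add: E'_def power_add eqE rem(4) algebra_simps)
      also have "\<dots> = g * w + fps_X ^ E' * (fps_X ^ (N - E') * \<beta> * s)"
        unfolding xy XN w_def by (simp add: algebra_simps)
      finally have main: "fps_X ^ E' * (y - fps_X ^ (N - E') * \<beta> * s) = g * w"
        by (simp add: algebra_simps)
      have "agree E' (g * w) (g * 0)"
        unfolding main[symmetric] by (simp add: agree_def fps_X_power_mult_nth)
      then have "agree E' w 0" using g'(2) by (rule agree_mult_cancel_left)
      then have "w = fps_X ^ E' * fps_shift E' w"
        using agree_imp_eq_add_X_power by fastforce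
      then have "fps_X ^ E' * (y - fps_X ^ (N - E') * \<beta> * s) = fps_X ^ E' * (g * fps_shift E' w)"
        using main by (metis mult.left_commute)
      then have "y - fps_X ^ (N - E') * \<beta> * s = g * fps_shift E' w"
        by simp
      then have "y - g * fps_shift E' w = fps_X ^ (N - E') * (\<beta> * s)"
        by (simp add: algebra_simps)
      then have "agree (N - E') y (g * fps_shift E' w)"
        by (metis X_power_dvd_diff_iff_agree dvd_triv_left)
      then have "agree M y (g * fps_shift E' w)"
        by (rule agree_mono) (use E'M in simp)
      then show ?thesis using integral_series_shift[OF w] by blast
    qed
  qed
qed

lemma prod_list_nonunit_series:
  assumes "\<forall>g\<in>set gs. nonunit_series g"
  shows "prod_list gs \<in> integral_series \<and> prod_list gs $ 0 \<noteq> 0 \<and>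
    int (length gs) \<le> v (prod_list gs $ 0) \<and> (\<forall>g\<in>set gs. v (g $ 0) \<le> v (prod_list gs $ 0))"
  using assms
proof (induction gs)
  case Nil
  then show ?case by (simp add: integral_series_1 v_1)
next
  case (Cons g gs)
  have "v (g $ 0 * prod_list gs $ 0) = v (g $ 0) + v (prod_list gs $ 0)"
    using Cons by (intro v_mult) (auto simp: nonunit_series_def)
  moreover have "0 \<le> v (prod_list gs $ 0)"
    using Cons by (intro integral_series_nth_0) auto
  ultimately show ?case
    using Cons by (force simp: nonunit_series_def integral_series_mult)
qed

text \<open>
  The factors in \<open>gs\<close> are split off one after the other, each going to \<open>x\<close> or to \<open>y\<close>; those that go
  to \<open>x\<close> form \<open>hs\<close>. Retaining precision \<open>N\<close> after one such step takes precision at most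
  \<open>T * m + 2 * N \<le> 3 * N\<close> before it, whence the power of \<open>3\<close>.
\<close>

lemma factor_of_irreducible_product:
  assumes T: "0 < T" and M: "0 < M"
    and gs: "\<forall>g\<in>set gs. irreducible_upto T g \<and> nat (v (g $ 0)) \<le> m"
    and x: "x \<in> integral_series" and y: "y \<in> integral_series"
    and eq: "agree ((M + T * m) * 3 ^ length gs) (x * y) (prod_list gs)"
  shows "\<exists>hs\<in>set (List.subseqs gs). \<exists>u. unit_series u \<and> agree M x (u * prod_list hs)"
  using gs x y eq
proof (induction gs arbitrary: x y)
  case Nil
  have "x $ 0 * y $ 0 = 1" using agree_nth_0[OF Nil.prems(4)] M by simp
  moreover from this have "x $ 0 \<noteq> 0" "y $ 0 \<noteq> 0" by auto
  ultimately have "v (x $ 0) + v (y $ 0) = 0" "x $ 0 \<noteq> 0" "y $ 0 \<noteq> 0"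
    using v_mult[of "x $ 0" "y $ 0"] v_1 by auto
  then have "unit_series x"
    using integral_series_nth_0[of x] integral_series_nth_0[of y] Nil by (simp add: unit_series_def)
  then show ?case by auto
next
  case (Cons g gs)
  define N where "N = (M + T * m) * 3 ^ length gs"
  have "(M + T * m) * 1 \<le> N" unfolding N_def by (intro mult_le_mono2) simp
  then have N: "M \<le> N" "T * m \<le> N" by auto
  have g: "irreducible_upto T g" "nat (v (g $ 0)) \<le> m" using Cons.prems by auto
  then have g0: "g \<in> integral_series" "g $ 0 \<noteq> 0"
    by (auto simp: irreducible_upto_def nonunit_series_def)
  have eq: "agree (3 * N) (x * y) (g * prod_list gs)"
    using Cons.prems(4) by (simp add: N_def mult.left_commute)
  have "prod_list gs \<in> integral_series"
    using prod_list_nonunit_series[of gs] Cons.prems(1) by (simp add: irreducible_upto_def)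
  moreover have "T * nat (v (g $ 0)) \<le> T * m" using g by (intro mult_le_mono2)
  moreover from this have "T * nat (v (g $ 0)) + 2 * N \<le> 3 * N" using N by linarith
  ultimately consider z where "z \<in> integral_series" "agree N x (g * z)"
    | z where "z \<in> integral_series" "agree N y (g * z)"
    using irreducible_upto_imp_prime[OF g(1) T Cons.prems(2,3) _ _ eq, of N] by blast
  then show ?case
  proof cases
    case 1
    have "agree N (g * (z * y)) (x * y)"
      using agree_mult[OF 1(2) agree_refl[of N y]] by (simp add: mult.assoc agree_sym)
    also have "agree N (x * y) (g * prod_list gs)" by (rule agree_mono[OF eq]) simp
    finally have "agree N (z * y) (prod_list gs)"
      using g0 agree_mult_cancel_left by blast
    then obtain hs u where hs: "hs \<in> set (List.subseqs gs)" "unit_series u" "agree M z (u * prod_list hs)"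
      using Cons.IH[of z y] Cons.prems 1 unfolding N_def by auto
    have "agree M x (g * z)" by (rule agree_mono[OF 1(2) N(1)])
    also have "agree M (g * z) (g * (u * prod_list hs))" by (rule agree_mult_left[OF hs(3)])
    finally have "agree M x (u * prod_list (g # hs))" by (simp add: mult.left_commute)
    moreover have "g # hs \<in> set (List.subseqs (g # gs))" using hs by (simp add: Let_def)
    ultimately show ?thesis using hs by blast
  next
    case 2
    have "agree N (g * (x * z)) (x * y)"
      using agree_mult_left[OF 2(2), of x] by (simp add: mult.left_commute agree_sym)
    also have "agree N (x * y) (g * prod_list gs)" by (rule agree_mono[OF eq]) simp
    finally have "agree N (x * z) (prod_list gs)"
      using g0 agree_mult_cancel_left by blast
    then obtain hs u where hs: "hs \<in> set (List.subseqs gs)" "unit_series u" "agree M x (u * prod_list hs)"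
      using Cons.IH[of x z] Cons.prems 2 unfolding N_def by auto
    moreover have "hs \<in> set (List.subseqs (g # gs))" using hs by (simp add: Let_def)
    ultimately show ?thesis by blast
  qed
qed

text \<open>
  The point is that \<open>T\<close> does not depend on \<open>N\<close>: the factors of a factorization of length \<open>r\<close>,
  however precise, are all irreducible modulo the same power \<open>t\<^sup>T\<close>, as otherwise one of them could be
  split to give length \<open>r + 1\<close>.
\<close>

lemma maximal_factorization:
  assumes f: "nonunit_series f"
  obtains r T where "0 < T"
    and "\<And>N. \<exists>gs. length gs = r \<and> (\<forall>g\<in>set gs. nonunit_series g) \<and> agree N f (prod_list gs)"
    and "\<And>gs. length gs = Suc r \<Longrightarrow> \<forall>g\<in>set gs. nonunit_series g \<Longrightarrow> \<not> agree T f (prod_list gs)"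
proof -
  define fact where "fact N r \<longleftrightarrow>
    (\<exists>gs. length gs = r \<and> (\<forall>g\<in>set gs. nonunit_series g) \<and> agree N f (prod_list gs))" for N r
  have bound: "r \<le> nat (v (f $ 0))" if r: "\<forall>N. fact N r" for r
  proof -
    obtain gs where gs: "length gs = r" "\<forall>g\<in>set gs. nonunit_series g" "agree 1 f (prod_list gs)"
      using r unfolding fact_def by blast
    then have "f $ 0 = prod_list gs $ 0" using agree_nth_0 by fastforce
    then have "int (length gs) \<le> v (f $ 0)" using prod_list_nonunit_series[OF gs(2)] by simp
    then show ?thesis using gs(1) by linarith
  qed
  have "fact N 1" for N
    unfolding fact_def using f by (intro exI[of _ "[f]"]) simp
  then have ex: "\<forall>N. fact N 1" by blast
  define r where "r = (GREATEST r. \<forall>N. fact N r)"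
  have r: "\<forall>N. fact N r"
    unfolding r_def by (rule GreatestI_nat[of "\<lambda>r. \<forall>N. fact N r", OF ex]) (use bound in blast)
  have "\<not> (\<forall>N. fact N (Suc r))"
    using Greatest_le_nat[of "\<lambda>r. \<forall>N. fact N r" "Suc r"] bound unfolding r_def
    by (metis Suc_n_not_le_n)
  then obtain T where T: "\<not> fact T (Suc r)" by blast
  have "\<not> fact (Suc T) (Suc r)"
    using T unfolding fact_def by (meson agree_mono le_SucI order_refl)
  then show ?thesis
    using r by (intro that[of "Suc T" r]) (auto simp: fact_def)
qed

lemma assoc_upto_of_agree_unit:
  assumes u: "unit_series u" and c: "c $ 0 \<noteq> 0" and M: "0 < M" and eq: "agree M x (u * c)"
  shows "assoc_upto valuation_ring M x c"
proof -
  have u0: "u $ 0 \<noteq> 0" using u by (simp add: unit_series_def)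
  have x0: "x $ 0 \<noteq> 0" using agree_nth_0[OF eq M] u0 c by simp
  have "agree M (x * inverse c) (u * c * inverse c)"
    by (rule agree_mult[OF eq]) simp
  then have 1: "agree M (x * inverse c) u"
    using c by (simp add: mult.assoc inverse_mult_eq_1')
  have "agree M (x * inverse u * inverse x) (u * c * inverse u * inverse x)"
    by (intro agree_mult eq) simp_all
  moreover have "x * inverse u * inverse x = inverse u"
    using inverse_mult_eq_1'[OF x0] by (metis mult.assoc mult.commute mult_1)
  moreover have "u * c * inverse u * inverse x = c * inverse x"
    using inverse_mult_eq_1'[OF u0] by (metis mult.assoc mult.commute mult_1)
  ultimately have 2: "agree M (c * inverse x) (inverse u)"
    by (simp add: agree_sym)
  show ?thesis
    using 1 2 u unit_series_inverse[OF u]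
    by (simp add: assoc_upto_def agree_def unit_series_def integral_series_def)
qed

lemma assoc_upto_trans:
  assumes "assoc_upto valuation_ring M x y" "assoc_upto valuation_ring M y z" "y $ 0 \<noteq> 0"
  shows "assoc_upto valuation_ring M x z"
proof -
  have y: "y * inverse y = 1" using assms(3) by (simp add: inverse_mult_eq_1')
  have mult: "(a * b) $ i \<in> valuation_ring"
    if "\<And>i. i < M \<Longrightarrow> a $ i \<in> valuation_ring" "\<And>i. i < M \<Longrightarrow> b $ i \<in> valuation_ring" "i < M"
    for a b :: "'k fps" and i
    using that by (auto simp: fps_mult_nth intro!: valuation_ring_sum valuation_ring_mult)
  have cancel: "a * b = (a * inverse y) * (y * b)" for a b
  proof -
    have "(a * inverse y) * (y * b) = (y * inverse y) * (a * b)" by (simp only: mult_ac)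
    then show ?thesis by (simp add: y)
  qed
  have "(x * inverse z) $ i \<in> valuation_ring" "(z * inverse x) $ i \<in> valuation_ring"
    if "i < M" for i
    unfolding cancel[of x "inverse z"] cancel[of z "inverse x"]
    by (rule mult; use assms(1,2) that in \<open>simp add: assoc_upto_def\<close>)+
  then show ?thesis by (simp add: assoc_upto_def)
qed

text \<open>
  The representatives in \<open>C\<close> are the subproducts of one factorization of maximal length, taken to a
  precision \<open>N\<close> high enough for approximate unique factorization to apply.
\<close>

lemma finite_factor_classes:
  assumes f: "nonunit_series f" and M: "0 < M"
  obtains N C where "finite C" and "\<And>c. c \<in> C \<Longrightarrow> c $ 0 \<noteq> 0"
    and "\<And>x y. x \<in> integral_series \<Longrightarrow> y \<in> integral_series \<Longrightarrow> agree N (x * y) f \<Longrightarrow>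
           \<exists>c\<in>C. assoc_upto valuation_ring M x c"
proof -
  obtain r T where T: "0 < T"
    and ex: "\<And>N. \<exists>gs. length gs = r \<and> (\<forall>g\<in>set gs. nonunit_series g) \<and> agree N f (prod_list gs)"
    and no: "\<And>gs. length gs = Suc r \<Longrightarrow> \<forall>g\<in>set gs. nonunit_series g \<Longrightarrow> \<not> agree T f (prod_list gs)"
    by (rule maximal_factorization[OF f]) (rule that)
  define m where "m = nat (v (f $ 0))"
  define N where "N = max T ((M + T * m) * 3 ^ r)"
  have N: "T \<le> N" "(M + T * m) * 3 ^ r \<le> N" by (simp_all add: N_def)
  obtain gs where len: "length gs = r" and gs: "\<forall>g\<in>set gs. nonunit_series g"
    and fgs: "agree N f (prod_list gs)" using ex by blast
  have f0: "f $ 0 = prod_list gs $ 0"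
    using agree_nth_0[OF fgs] T N by simp
  have irr: "irreducible_upto T g \<and> nat (v (g $ 0)) \<le> m" if g: "g \<in> set gs" for g
  proof
    show "nat (v (g $ 0)) \<le> m"
      using prod_list_nonunit_series[OF gs] g by (simp add: m_def f0 nat_mono)
    show "irreducible_upto T g"
      unfolding irreducible_upto_def
    proof (intro conjI notI)
      show "nonunit_series g" using gs g by blast
      assume "\<exists>d e. nonunit_series d \<and> nonunit_series e \<and> agree T g (d * e)"
      then obtain d e where de: "nonunit_series d" "nonunit_series e" "agree T g (d * e)" by blast
      obtain as bs where split: "gs = as @ g # bs" using g by (metis split_list)
      have "agree T f (prod_list gs)" by (rule agree_mono[OF fgs N(1)])
      also have "agree T (prod_list gs) (prod_list (as @ d # e # bs))"
        using agree_mult_left[OF agree_mult[OF de(3) agree_refl], of "prod_list as" "prod_list bs"]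
        by (simp add: split mult.assoc)
      finally have "agree T f (prod_list (as @ d # e # bs))" .
      moreover have "length (as @ d # e # bs) = Suc r" using len split by simp
      moreover have "\<forall>h\<in>set (as @ d # e # bs). nonunit_series h" using gs de split by auto
      ultimately show False using no by blast
    qed
  qed
  show ?thesis
  proof (rule that[of "prod_list ` set (List.subseqs gs)" N])
    show "finite (prod_list ` set (List.subseqs gs))" by simp
    show c0: "c $ 0 \<noteq> 0" if "c \<in> prod_list ` set (List.subseqs gs)" for c
    proof -
      obtain hs where hs: "hs \<in> set (List.subseqs gs)" "c = prod_list hs" using \<open>c \<in> _\<close> by blast
      then have "set hs \<subseteq> set gs" using subseqs_powset[of gs] by blast
      then show ?thesis using prod_list_nonunit_series[of hs] gs hs by blast
    qed
    fix x y assume xy: "x \<in> integral_series" "y \<in> integral_series" "agree N (x * y) f"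
    have "agree N (x * y) (prod_list gs)" using xy(3) fgs by (rule agree_trans)
    then have "agree ((M + T * m) * 3 ^ length gs) (x * y) (prod_list gs)"
      using N(2) len by (auto intro: agree_mono)
    then obtain hs u where hs: "hs \<in> set (List.subseqs gs)" "unit_series u" "agree M x (u * prod_list hs)"
      using factor_of_irreducible_product[OF T M _ xy(1,2), of gs m] irr by blast
    then have "assoc_upto valuation_ring M x (prod_list hs)"
      using c0 M by (intro assoc_upto_of_agree_unit) auto
    then show "\<exists>c\<in>prod_list ` set (List.subseqs gs). assoc_upto valuation_ring M x c"
      using hs by blast
  qed
qed

lemma factors_of_unit_assoc:
  assumes x: "x \<in> integral_series" "y \<in> integral_series" "x $ 0 * y $ 0 \<noteq> 0" "v (x $ 0 * y $ 0) = 0"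
    and x': "x' \<in> integral_series" "y' \<in> integral_series" "x' $ 0 * y' $ 0 \<noteq> 0" "v (x' $ 0 * y' $ 0) = 0"
  shows "assoc_upto valuation_ring M x x'"
proof -
  have *: "unit_series x" if "x \<in> integral_series" "y \<in> integral_series" "x $ 0 * y $ 0 \<noteq> 0"
    "v (x $ 0 * y $ 0) = 0" for x y
    using that v_mult[of "x $ 0" "y $ 0"] integral_series_nth_0[of x] integral_series_nth_0[of y]
    by (simp add: unit_series_def)
  have "unit_series x" "unit_series x'" using *[OF x] *[OF x'] .
  then show ?thesis
    using unit_series_inverse[of x] unit_series_inverse[of x']
      integral_series_mult[of x "inverse x'"] integral_series_mult[of x' "inverse x"]
    by (simp add: assoc_upto_def integral_series_def unit_series_def)
qed

lemma approximate_factors_subsequence: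
  assumes f: "f \<in> integral_series" "f $ 0 \<noteq> 0" and M: "0 < M"
    and g: "\<And>n. g n \<in> integral_series" and h: "\<And>n. h n \<in> integral_series"
    and eq: "\<And>n. agree (Suc n) (g n * h n) f"
    and s: "strict_mono s"
  shows "\<exists>r :: nat \<Rightarrow> nat. strict_mono r \<and> (\<forall>i j. assoc_upto valuation_ring M (g (s (r i))) (g (s (r j))))"
proof (cases "v (f $ 0) = 0")
  case True
  have "g n $ 0 * h n $ 0 = f $ 0" for n using agree_nth_0[OF eq[of n]] by simp
  then have "assoc_upto valuation_ring M (g i) (g j)" for i j
    using True f g h by (intro factors_of_unit_assoc[of _ "h i" _ "h j"]) auto
  then show ?thesis by (intro exI[of _ id]) (simp add: strict_mono_def)
next
  case False
  then have "nonunit_series f"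
    using f integral_series_nth_0[of f] by (simp add: nonunit_series_def)
  then obtain N C where C: "finite C" "\<And>c. c \<in> C \<Longrightarrow> c $ 0 \<noteq> 0"
    and cov: "\<And>x y. x \<in> integral_series \<Longrightarrow> y \<in> integral_series \<Longrightarrow> agree N (x * y) f \<Longrightarrow>
           \<exists>c\<in>C. assoc_upto valuation_ring M x c"
    by (rule finite_factor_classes[OF _ M]) (rule that)
  have "\<exists>c\<in>C. assoc_upto valuation_ring M (g (s n)) c" if "n \<ge> N" for n
    using that seq_suble[OF s, of n] by (intro cov[OF g h]) (rule agree_mono[OF eq], simp)
  then obtain \<kappa> where \<kappa>: "\<And>n. n \<ge> N \<Longrightarrow> \<kappa> n \<in> C \<and> assoc_upto valuation_ring M (g (s n)) (\<kappa> n)"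
    by metis
  have "\<kappa> ` {N..} \<subseteq> C" using \<kappa> by auto
  then have "finite (\<kappa> ` {N..})" using C(1) finite_subset by blast
  then obtain c where inf: "infinite {n\<in>{N..}. \<kappa> n = c}" and c: "c \<in> C"
    using pigeonhole_infinite[of "{N..}" \<kappa>] \<kappa> infinite_Ici by fastforce
  define J where "J = {n\<in>{N..}. \<kappa> n = c}"
  have "assoc_upto valuation_ring M (g (s i)) (g (s j))" if "i \<in> J" "j \<in> J" for i j
    using assoc_upto_trans[of M "g (s i)" c "g (s j)"] \<kappa>[of i] \<kappa>[of j] that C(2)[OF c]
    by (auto simp: J_def assoc_upto_sym)
  moreover have "strict_mono (enumerate J)" "\<And>n. enumerate J n \<in> J"
    using inf strict_mono_enumerate enumerate_in_set unfolding J_def by blast+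
  ultimately show ?thesis by blast
qed

end


section \<open>Gluing over the height-one primes\<close>

definition fract_fps :: "'a::idom fps \<Rightarrow> 'a fract fps" where
  "fract_fps x = Abs_fps (\<lambda>i. to_fract (x $ i))"

lemma fract_fps_nth [simp]: "fract_fps x $ i = to_fract (x $ i)"
  by (simp add: fract_fps_def)

lemma fract_fps_mult: "fract_fps (x * y) = fract_fps x * fract_fps y"
  by (simp add: fps_eq_iff fps_mult_nth)

lemma agree_fract_fps_iff: "agree n (fract_fps x) (fract_fps y) \<longleftrightarrow> agree n x y"
  by (simp add: agree_def)

lemma localization_at_height_one_valuation:
  fixes P :: "'a::idom set"
  assumes K: "krull_domain TYPE('a)" and P: "P \<in> height_one_primes"
  obtains v where "discretely_valued_field v"
    and "discretely_valued_field.valuation_ring v = localization_at P"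
    and "\<And>x. fract_fps x \<in> discretely_valued_field.integral_series v"
    and "\<And>a. a \<notin> P \<Longrightarrow> a \<noteq> 0 \<Longrightarrow> v (to_fract a) = 0"
proof -
  have "is_DVR (localization_at P)" using K P by (auto simp: krull_domain_def)
  then obtain v where v: "discrete_valuation v" "localization_at P = {x. x = 0 \<or> v x \<ge> 0}"
    unfolding is_DVR_def by blast
  interpret discretely_valued_field v by unfold_locales (rule v(1))
  have ring: "valuation_ring = localization_at P" by (simp add: v(2) valuation_ring_def)
  have "(\<Inter>P\<in>height_one_primes. localization_at P) = range (to_fract :: 'a \<Rightarrow> _)"
    using K by (simp add: krull_domain_def)
  then have to_fract: "to_fract a \<in> valuation_ring" for a :: 'a
    unfolding ring using P by blast
  have "v (to_fract a) = 0" if a: "a \<notin> P" "a \<noteq> 0" for a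
  proof -
    have "to_fract 1 / to_fract a \<in> localization_at P"
      using a unfolding localization_at_def by blast
    then have "inverse (to_fract a) \<in> valuation_ring" by (simp add: ring inverse_eq_divide)
    then show ?thesis
      using to_fract[of a] a v_inverse[of "to_fract a"] by (simp add: valuation_ring_def)
  qed
  then show ?thesis
    using to_fract ring discretely_valued_field_axioms
    by (intro that[of v]) (auto simp: integral_series_def)
qed

lemma approximate_factors_subsequence_finite:
  fixes f :: "'a::idom fps"
  assumes K: "krull_domain TYPE('a)" and f: "f $ 0 \<noteq> 0" and M: "0 < M"
    and eq: "\<And>n. agree (Suc n) (g n * h n) f"
    and S: "finite S" "S \<subseteq> height_one_primes" and s: "strict_mono s"
  shows "\<exists>r :: nat \<Rightarrow> nat. strict_mono r \<and> (\<forall>P\<in>S. \<forall>i j.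
    assoc_upto (localization_at P) M (fract_fps (g (s (r i)))) (fract_fps (g (s (r j)))))"
  using S
proof (induction S)
  case empty
  then show ?case by (intro exI[of _ id]) (simp add: strict_mono_def)
next
  case (insert P S)
  have P: "P \<in> height_one_primes" and S: "S \<subseteq> height_one_primes" using insert.prems by simp_all
  obtain r :: "nat \<Rightarrow> nat" where r: "strict_mono r" "\<forall>P\<in>S. \<forall>i j.
    assoc_upto (localization_at P) M (fract_fps (g (s (r i)))) (fract_fps (g (s (r j))))"
    using insert.IH[OF S] by (elim exE conjE)
  obtain v where v: "discretely_valued_field v"
    and ring: "discretely_valued_field.valuation_ring v = localization_at P"
    and int: "\<And>x :: 'a fps. fract_fps x \<in> discretely_valued_field.integral_series v"
    by (rule localization_at_height_one_valuation[OF K P]) (rule that)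
  interpret discretely_valued_field v by (rule v)
  have "agree (Suc n) (fract_fps (g n) * fract_fps (h n)) (fract_fps f)" for n
    using eq by (simp add: agree_fract_fps_iff flip: fract_fps_mult)
  moreover have "strict_mono (s \<circ> r)" using s r(1) by (rule strict_mono_o)
  ultimately obtain r' :: "nat \<Rightarrow> nat" where r': "strict_mono r'" "\<forall>i j. assoc_upto valuation_ring M
      (fract_fps (g ((s \<circ> r) (r' i)))) (fract_fps (g ((s \<circ> r) (r' j))))"
    using approximate_factors_subsequence[of "fract_fps f" M "\<lambda>n. fract_fps (g n)"
        "\<lambda>n. fract_fps (h n)" "s \<circ> r"] f M int by auto
  show ?case
    using r r' strict_mono_o[OF r(1) r'(1)]
    by (intro exI[of _ "\<lambda>i. r (r' i)"]) (auto simp: o_def simp flip: ring)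
qed

text \<open>
  The coefficients of both quotients lie in every localization at a height-one prime, hence in the
  Krull domain itself.
\<close>

lemma krull_unit_quotient:
  fixes x y :: "'a::idom fps"
  assumes K: "krull_domain TYPE('a)" and M: "0 < M" and x0: "x $ 0 \<noteq> 0" and y0: "y $ 0 \<noteq> 0"
    and assoc: "\<And>P :: 'a set. P \<in> height_one_primes \<Longrightarrow>
      assoc_upto (localization_at P) M (fract_fps x) (fract_fps y)"
  shows "\<exists>u. u dvd 1 \<and> agree M y (u * x)"
proof -
  have inter: "(\<Inter>P\<in>height_one_primes. localization_at P) = range (to_fract :: 'a \<Rightarrow> _)"
    using K by (simp add: krull_domain_def)
  have quot: "\<exists>u. agree M y (u * x)" if x0: "x $ 0 \<noteq> 0"
    and *: "\<And>P :: 'a set. P \<in> height_one_primes \<Longrightarrow>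
      assoc_upto (localization_at P) M (fract_fps x) (fract_fps y)" for x y :: "'a fps"
  proof -
    define z where "z = fract_fps y * inverse (fract_fps x)"
    have "\<exists>c. z $ i = to_fract c" if "i < M" for i
    proof -
      have "z $ i \<in> (\<Inter>P\<in>(height_one_primes :: 'a set set). localization_at P)"
        using * that unfolding z_def assoc_upto_def by blast
      then show ?thesis unfolding inter by blast
    qed
    then obtain c where c: "\<And>i. i < M \<Longrightarrow> z $ i = to_fract (c i)" by metis
    define u where "u = Abs_fps c"
    have "z * fract_fps x = fract_fps y"
      using inverse_mult_eq_1[of "fract_fps x"] x0 by (simp add: z_def mult.assoc)
    moreover have "agree M z (fract_fps u)" using c by (simp add: agree_def u_def)
    ultimately have "agree M (fract_fps y) (fract_fps u * fract_fps x)"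
      using agree_mult[OF _ agree_refl[of M "fract_fps x"]] by metis
    then show ?thesis by (auto simp: agree_fract_fps_iff simp flip: fract_fps_mult)
  qed
  obtain u where u: "agree M y (u * x)" using quot[OF x0 assoc] by blast
  obtain u' where u': "agree M x (u' * y)"
    using quot[OF y0] assoc assoc_upto_sym by blast
  have "y $ 0 = u $ 0 * x $ 0" "x $ 0 = u' $ 0 * y $ 0"
    using agree_nth_0[OF u M] agree_nth_0[OF u' M] by simp_all
  then have "x $ 0 * (u $ 0 * u' $ 0) = x $ 0 * 1" by (metis mult.assoc mult.commute mult_1_right)
  then have "u $ 0 * u' $ 0 = 1" using x0 by (metis mult_left_cancel)
  then have "u dvd 1" unfolding fps_dvd_1_iff by (metis dvd_triv_left)
  then show ?thesis using u by blast
qed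

text \<open>
  The primes containing \<open>f $ 0\<close> are treated one by one, each time refining the subsequence. At all
  other height-one primes the series \<open>g n\<close> are units and so associated without further refinement.
\<close>

lemma krull_approximate_factors_subsequence:
  fixes f :: "'a::idom fps"
  assumes K: "krull_domain TYPE('a)" and f: "f $ 0 \<noteq> 0" and M: "0 < M"
    and eq: "\<And>n. agree (Suc n) (g n * h n) f"
    and s: "strict_mono s"
  shows "\<exists>r :: nat \<Rightarrow> nat. strict_mono r \<and> (\<forall>i j. \<exists>u. u dvd 1 \<and> agree M (g (s (r j))) (u * g (s (r i))))"
proof -
  define S where "S = {P \<in> height_one_primes. f $ 0 \<in> P}"
  have "finite S" using K f unfolding S_def krull_domain_def by blast
  moreover have "S \<subseteq> height_one_primes" by (auto simp: S_def)
  ultimately have "\<exists>r :: nat \<Rightarrow> nat. strict_mono r \<and> (\<forall>P\<in>S. \<forall>i j.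
    assoc_upto (localization_at P) M (fract_fps (g (s (r i)))) (fract_fps (g (s (r j)))))"
    by (rule approximate_factors_subsequence_finite[OF K f M eq _ _ s])
  then obtain r :: "nat \<Rightarrow> nat" where r: "strict_mono r" and rS: "\<forall>P\<in>S. \<forall>i j.
    assoc_upto (localization_at P) M (fract_fps (g (s (r i)))) (fract_fps (g (s (r j))))"
    by (elim exE conjE)
  have f0: "g n $ 0 * h n $ 0 = f $ 0" for n using agree_nth_0[OF eq[of n]] by simp
  have "assoc_upto (localization_at P) M (fract_fps (g (s (r i)))) (fract_fps (g (s (r j))))"
    if P: "P \<in> height_one_primes" for P i j
  proof (cases "f $ 0 \<in> P")
    case True
    then show ?thesis using P rS by (simp add: S_def)
  next
    case False
    obtain v where v: "discretely_valued_field v"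
      and ring: "discretely_valued_field.valuation_ring v = localization_at P"
      and int: "\<And>x :: 'a fps. fract_fps x \<in> discretely_valued_field.integral_series v"
      and unit: "\<And>a. a \<notin> P \<Longrightarrow> a \<noteq> 0 \<Longrightarrow> v (to_fract a) = 0"
      by (rule localization_at_height_one_valuation[OF K P]) (rule that)
    have v0: "v (to_fract (f $ 0)) = 0" using unit False f by blast
    interpret discretely_valued_field v by (rule v)
    show ?thesis
      unfolding ring[symmetric]
      using int v0 f f0
      by (intro factors_of_unit_assoc[of _ "fract_fps (h (s (r i)))" _ "fract_fps (h (s (r j)))"])
        (auto simp flip: to_fract_mult)
  qed
  moreover have "g n $ 0 \<noteq> 0" for n using f0[of n] f by auto
  ultimately have "\<exists>u. u dvd 1 \<and> agree M (g (s (r j))) (u * g (s (r i)))" for i j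
    by (intro krull_unit_quotient[OF K M]) auto
  then show ?thesis using r by blast
qed


section \<open>Passing to the limit\<close>

lemma agree_limit:
  assumes step: "\<And>n. agree (Suc n) (F (Suc n)) (F n)"
  shows "agree (Suc n) (Abs_fps (\<lambda>i. F i $ i)) (F n)"
proof -
  have *: "agree (Suc n) (F (n + k)) (F n)" for n k
  proof (induction k)
    case (Suc k)
    have "agree (Suc n) (F (Suc (n + k))) (F (n + k))" by (rule agree_mono[OF step]) simp
    then show ?case using Suc agree_trans by fastforce
  qed simp
  then have "F i $ i = F n $ i" if "i < Suc n" for i
    using *[of i "n - i"] that by (simp add: agree_def)
  then show ?thesis by (simp add: agree_def)
qed

text \<open>
  Rescaling the first factors successively by units turns them into a sequence \<open>F\<close> that converges
  \<open>t\<close>-adically. Since the first factors have non-zero constant terms, the rescaled cofactors are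
  determined to the same precision and converge as well.
\<close>

lemma limit_of_approximate_factorizations:
  fixes f :: "'a::idom fps"
  assumes f: "f $ 0 \<noteq> 0"
    and eq: "\<And>n. agree (Suc n) (k n * h n) f"
    and k: "\<And>n. \<not> k n dvd 1" and h: "\<And>n. \<not> h n dvd 1"
    and step: "\<And>n. \<exists>u. u dvd 1 \<and> agree (Suc n) (k (Suc n)) (u * k n)"
  shows "\<exists>G H. f = G * H \<and> \<not> G dvd 1 \<and> \<not> H dvd 1"
proof -
  have "\<exists>F. \<forall>n. (\<exists>w. w dvd 1 \<and> F n = w * k n) \<and> agree (Suc n) (F (Suc n)) (F n)"
  proof (rule dependent_nat_choice)
    show "\<exists>x w. w dvd 1 \<and> x = w * k 0" by (metis dvd_refl)
    fix x n assume "\<exists>w. w dvd 1 \<and> x = w * k n"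
    then obtain w where w: "w dvd 1" "x = w * k n" by blast
    obtain u where u: "u dvd 1" "agree (Suc n) (k (Suc n)) (u * k n)" using step by blast
    obtain u' where u': "u * u' = 1" using u(1) by (metis dvdE)
    have "agree (Suc n) (w * u' * k (Suc n)) (w * u' * (u * k n))"
      by (rule agree_mult_left[OF u(2)])
    also have "w * u' * (u * k n) = x"
      using u' w(2) by (metis mult.assoc mult.commute mult_1_right)
    finally have "agree (Suc n) (w * u' * k (Suc n)) x" .
    moreover have "u' dvd 1" using u' by (metis dvd_triv_right)
    then have "w * u' dvd 1" using w(1) mult_dvd_mono[of w 1 u' 1] by simp
    ultimately show "\<exists>y. (\<exists>w. w dvd 1 \<and> y = w * k (Suc n)) \<and> agree (Suc n) y x" by blast
  qed
  then obtain F where F: "\<And>n. \<exists>w. w dvd 1 \<and> F n = w * k n"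
    and Fstep: "\<And>n. agree (Suc n) (F (Suc n)) (F n)" by blast
  have "\<exists>H. agree (Suc n) (F n * H) f \<and> \<not> H dvd 1" for n
  proof -
    obtain w w' where w: "F n = w * k n" "w * w' = 1" using F by (metis dvdE)
    then have "F n * (w' * h n) = k n * h n"
      by (metis mult.assoc mult.commute mult_1_right)
    moreover have "\<not> w' * h n dvd 1" using h dvd_mult_right by blast
    ultimately show ?thesis using eq by metis
  qed
  then obtain H where H: "\<And>n. agree (Suc n) (F n * H n) f" and Hn: "\<And>n. \<not> H n dvd 1" by metis
  have F0: "F n $ 0 \<noteq> 0" for n using agree_nth_0[OF H[of n]] f by auto
  have Hstep: "agree (Suc n) (H (Suc n)) (H n)" for n
  proof -
    have "agree (Suc n) (F n * H (Suc n)) (F (Suc n) * H (Suc n))"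
      by (intro agree_mult agree_sym[OF Fstep]) simp
    also have "agree (Suc n) (F (Suc n) * H (Suc n)) f" by (rule agree_mono[OF H]) simp
    also have "agree (Suc n) f (F n * H n)" by (rule agree_sym[OF H])
    finally show ?thesis using F0 agree_mult_cancel_left by blast
  qed
  define G where "G = Abs_fps (\<lambda>i. F i $ i)"
  define L where "L = Abs_fps (\<lambda>i. H i $ i)"
  have G: "agree (Suc n) G (F n)" and L: "agree (Suc n) L (H n)" for n
    unfolding G_def L_def by (rule agree_limit[OF Fstep] agree_limit[OF Hstep])+
  have "agree (Suc n) (G * L) f" for n
    using agree_mult[OF G L] H agree_trans by blast
  then have "f = G * L" by (simp add: fps_eq_iff agree_def) (metis lessI)
  moreover have "\<not> F 0 dvd 1" using F k dvd_mult_right by metis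
  then have "\<not> G dvd 1" using agree_nth_0[OF G[of 0]] by (simp add: fps_dvd_1_iff)
  moreover have "\<not> L dvd 1" using agree_nth_0[OF L[of 0]] Hn[of 0] by (simp add: fps_dvd_1_iff)
  ultimately show ?thesis by blast
qed

lemma irreducible_nth_0_eq_0_imp_irreducible_mod_X_squared:
  fixes f :: "'a::idom fps"
  assumes f: "Factorial_Ring.irreducible f" and f0: "f $ 0 = 0"
  shows "irreducible_mod_X_power 2 f"
proof -
  have nX: "\<not> fps_X dvd (1 :: 'a fps)" by (simp add: fps_dvd_1_iff)
  have "agree 1 f 0" using f0 by (simp add: agree_def)
  then have fX: "f = fps_X * fps_shift 1 f"
    using agree_imp_eq_add_X_power[of 1 f 0] by simp
  then have "fps_shift 1 f dvd 1"
    using f nX unfolding Factorial_Ring.irreducible_def by blast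
  then have f1: "f $ 1 dvd 1" by (simp add: fps_dvd_1_iff)
  have "g dvd 1 \<or> h dvd 1" if "agree 2 f (g * h)" for g h
  proof -
    have 0: "g $ 0 * h $ 0 = 0" using agree_nth_0[OF that] f0 by simp
    have 1: "f $ 1 = g $ 0 * h $ 1 + g $ 1 * h $ 0"
      using that by (simp add: agree_def fps_mult_nth_1)
    show ?thesis
    proof (cases "g $ 0 = 0")
      case True
      then have "h $ 0 dvd f $ 1" using 1 by simp
      then show ?thesis using f1 by (auto simp: fps_dvd_1_iff intro: dvd_trans)
    next
      case False
      then have "g $ 0 dvd f $ 1" using 0 1 by simp
      then show ?thesis using f1 by (auto simp: fps_dvd_1_iff intro: dvd_trans)
    qed
  qed
  moreover have "\<not> f dvd 1" using f by (simp add: Factorial_Ring.irreducible_def)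
  ultimately show ?thesis
    unfolding irreducible_mod_X_power_def X_power_dvd_diff_iff_agree by blast
qed

theorem theorem2:
  fixes f :: "'a::idom fps"
  assumes "krull_domain TYPE('a)"
    and "Factorial_Ring.irreducible f"
  shows "\<exists>n\<ge>1. irreducible_mod_X_power n f"
proof (rule ccontr)
  assume neg: "\<not> ?thesis"
  have f0: "f $ 0 \<noteq> 0"
    using neg irreducible_nth_0_eq_0_imp_irreducible_mod_X_squared[OF assms(2)] by fastforce
  have "\<not> f dvd 1" using assms(2) by (simp add: Factorial_Ring.irreducible_def)
  moreover have "\<not> irreducible_mod_X_power (Suc n) f" for n using neg by auto
  ultimately have "\<exists>g h. \<not> g dvd 1 \<and> \<not> h dvd 1 \<and> agree (Suc n) (g * h) f" for n
    unfolding irreducible_mod_X_power_def X_power_dvd_diff_iff_agree by (metis agree_sym)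
  then obtain g h where g: "\<And>n. \<not> g n dvd 1" and h: "\<And>n. \<not> h n dvd 1"
    and eq: "\<And>n. agree (Suc n) (g n * h n) f" by metis
  define P where "P n s \<longleftrightarrow> (\<forall>i j. \<exists>u. u dvd 1 \<and> agree (Suc n) (g (s j)) (u * g (s i)))" for n and s :: "nat \<Rightarrow> nat"
  interpret subseqs P
    using krull_approximate_factors_subsequence[OF assms(1) f0 _ eq]
    by unfold_locales (simp add: P_def)
  have P: "P n (diagseq \<circ> (+) (Suc n))" for n
    by (rule diagseq_holds) (auto simp: P_def)
  \<comment> \<open>From index \<open>Suc n\<close> on, the diagonal sequence is a subsequence of the \<open>n\<close>-th refinement.\<close>
  define k where "k n = diagseq (Suc n)" for n
  have PD: "\<exists>u. u dvd 1 \<and> agree (Suc n) (g (s j)) (u * g (s i))" if "P n s" for n s i j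
    using that unfolding P_def by blast
  have step: "\<exists>u. u dvd 1 \<and> agree (Suc n) (g (k (Suc n))) (u * g (k n))" for n
    using PD[OF P[of n], of 1 0] by (simp add: k_def)
  have "agree (Suc n) (g (k n) * h (k n)) f" for n
    by (rule agree_mono[OF eq]) (use seq_suble[OF subseq_diagseq, of "Suc n"] in \<open>simp add: k_def\<close>)
  then have "\<exists>G H. f = G * H \<and> \<not> G dvd 1 \<and> \<not> H dvd 1"
    by (rule limit_of_approximate_factorizations[OF f0 _ g h step])
  then show False using assms(2) by (auto simp: Factorial_Ring.irreducible_def)
qed

end
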